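(* Assume $d_{OD}>0$ for every OD pair. Let $\hat{\mathbf h}$ be the logit-based stochastic user equilibrium path flow, i.e. the feasible path flow vector with $\hat{\mathbf h}=\mathcal{L}(\hat{\mathbf h})$, and for feasible $\mathbf h$ let $\boldsymbol\delta(\mathbf h)\in\mathbb{R}^n$ be the unique solution of the reduced Newton system $(\mathbf I-\mathcal{K}(\mathbf h))\,\boldsymbol\delta=\mathcal{L}(\mathbf h)-\mathbf h$. Then there is a neighborhood of $\hat{\mathbf h}$ such that for every feasible $\mathbf h$ in it, the vector $\mathbf h+\boldsymbol\delta(\mathbf h)$ is feasible and has strictly positive components; and there is a neighborhood of $\hat{\mathbf h}$ such that for every feasible starting point $\mathbf h^0$ in it, the iteration $\mathbf h^{k+1}=\mathbf h^k+\boldsymbol\delta(\mathbf h^k)$ is well defined, stays feasible, and converges to $\hat{\mathbf h}$ quadratically, i.e. there is $C>0$ with $\|\mathbf h^{k+1}-\hat{\mathbf h}\|\le C\|\mathbf h^k-\hat{\mathbf h}\|^2$ for all $k$.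
   Context: Network setting. There is a finite set $\mathbb{L}$ of links and a finite nonempty set of origin-destination (OD) pairs. Each OD pair has a demand $d_{OD}$ and a fixed finite nonempty set $\mathbb{P}_{OD}$ of acyclic paths; $\mathbb{P}$ is the disjoint union of the $\mathbb{P}_{OD}$, $n=|\mathbb{P}|$, and $OD(i)$ is the OD pair of path $i$. $\mathbf{D}\in\{0,1\}^{|\mathbb{L}|\times n}$ is the link-path incidence matrix ($D_{li}=1$ iff link $l$ is on path $i$). A vector $\mathbf{h}\in\mathbb{R}^n$ is a feasible path flow vector if $h_i\ge 0$ for all $i$ and $\sum_{i\in\mathbb{P}_{OD}}h_i=d_{OD}$ for every OD pair. Costs. The cost of link $l$ depends only on its own flow $a_l$ via $\tau_l:[0,\infty)\to[0,\infty)$, which is twice continuously differentiable and monotone non-decreasing, with $\tau_l'$ Lipschitz on the bounded set of link flows arising from feasible path flows. Link flows are $\mathbf a=\mathbf D\mathbf h$, path costs are $\mathcal{C}(\mathbf h)=\mathbf{D}^T\mathcal{T}(\mathbf{D}\mathbf{h})$ with $\mathcal{T}_l(\mathbf a)=\tau_l(a_l)$, and the Jacobian is $\mathcal{C}'(\mathbf h)=\mathbf D^T\operatorname{diag}(\tau_l'(a_l))\mathbf D$. Logit model. $\theta>0$ is a fixed parameter. For a path cost vector $\mathbf c$, $\mathcal{P}(\mathbf c)_i=\exp(-\theta c_i)/\sum_{i'\in\mathbb{P}_{OD(i)}}\exp(-\theta c_{i'})$. Put $\mathcal{H}(\mathbf h,\mathbf p)_i=\bigl(\sum_{i'\in\mathbb{P}_{OD(i)}}h_{i'}\bigr)p_i$.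 The logit mapping is $\mathcal{L}(\mathbf h)=\mathcal{H}(\mathbf h,\mathcal{P}(\mathcal{C}(\mathbf h)))$. $\mathcal{P}'(\mathbf c)$ is the Jacobian of $\mathcal{P}$, and $\mathcal{H}'_{\mathbf p}(\mathbf h)$ is the Jacobian of $\mathcal{H}$ in $\mathbf p$ with $\mathbf h$ fixed (for feasible $\mathbf h$, the diagonal matrix with entries $d_{OD(i)}$). The reduced Jacobian is $\mathcal{K}(\mathbf h)=\mathcal{H}'_{\mathbf p}(\mathbf h)\,\mathcal{P}'(\mathbf c)\,\mathcal{C}'(\mathbf h)$ with $\mathbf c=\mathcal{C}(\mathbf h)$; for feasible $\mathbf h$ all its eigenvalues are real and non-positive, so $\mathbf I-\mathcal{K}(\mathbf h)$ is invertible. It is known (Fisk) that the feasible fixed point $\hat{\mathbf h}$ of $\mathcal{L}$ exists and is unique. $\|\cdot\|$ is the $\ell_2$ norm. *)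

theory Defs
  imports "HOL-Analysis.Analysis"
begin

text \<open>
  Links, paths and OD pairs are indexed by finite types, so vectors of path and link
  flows live in \<open>real ^ 'p\<close> and \<open>real ^ 'l\<close>.  A path index \<open>i\<close> carries its OD pair
  \<open>od i\<close> and its list of links \<open>route i\<close>, so that \<open>'p\<close> plays the role of the disjoint
  union of the path sets of the OD pairs \<open>w\<close>, each being \<open>{i. od i = w}\<close>.
\<close>

fun walk :: "('l \<Rightarrow> 'v) \<Rightarrow> ('l \<Rightarrow> 'v) \<Rightarrow> 'v \<Rightarrow> 'l list \<Rightarrow> 'v \<Rightarrow> bool" where
  "walk tail head s [] t \<longleftrightarrow> s = t"
| "walk tail head s (l # ls) t \<longleftrightarrow> tail l = s \<and> walk tail head (head l) ls t"

definition acyclic_path :: "('l \<Rightarrow> 'v) \<Rightarrow> ('l \<Rightarrow> 'v) \<Rightarrow> 'v \<Rightarrow> 'l list \<Rightarrow> 'v \<Rightarrow> bool" where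
  "acyclic_path tail head s ls t \<longleftrightarrow> walk tail head s ls t \<and> distinct (s # map head ls)"

text \<open>
  Surjectivity of \<open>od\<close> says that every OD pair has at least one path; the second
  injectivity condition says that the paths of one OD pair form a set, i.e. are not repeated.
\<close>

definition network ::
  "('l::finite \<Rightarrow> 'v) \<Rightarrow> ('l \<Rightarrow> 'v) \<Rightarrow> ('w::finite \<Rightarrow> 'v) \<Rightarrow> ('w \<Rightarrow> 'v) \<Rightarrow>
   ('p::finite \<Rightarrow> 'w) \<Rightarrow> ('p \<Rightarrow> 'l list) \<Rightarrow> bool" where
  "network tail head orig dest od route \<longleftrightarrow>
     inj (\<lambda>w. (orig w, dest w)) \<and>
     surj od \<and>
     inj (\<lambda>i. (od i, route i)) \<and>
     (\<forall>i. acyclic_path tail head (orig (od i)) (route i) (dest (od i)))"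

definition feasible ::
  "('p::finite \<Rightarrow> 'w) \<Rightarrow> ('w \<Rightarrow> real) \<Rightarrow> real ^ 'p \<Rightarrow> bool" where
  "feasible od d h \<longleftrightarrow> (\<forall>i. 0 \<le> h $ i) \<and> (\<forall>w. (\<Sum>i | od i = w. h $ i) = d w)"

definition incidence :: "('p::finite \<Rightarrow> 'l::finite list) \<Rightarrow> real ^ 'p ^ 'l" where
  "incidence route = (\<chi> l i. if l \<in> set (route i) then 1 else 0)"

definition link_flow :: "('p::finite \<Rightarrow> 'l::finite list) \<Rightarrow> real ^ 'p \<Rightarrow> real ^ 'l" where
  "link_flow route h = incidence route *v h"

definition link_costs :: "('l::finite \<Rightarrow> real \<Rightarrow> real) \<Rightarrow> real ^ 'l \<Rightarrow> real ^ 'l" where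
  "link_costs \<tau> a = (\<chi> l. \<tau> l (a $ l))"

definition path_costs ::
  "('p::finite \<Rightarrow> 'l::finite list) \<Rightarrow> ('l \<Rightarrow> real \<Rightarrow> real) \<Rightarrow> real ^ 'p \<Rightarrow> real ^ 'p" where
  "path_costs route \<tau> h = transpose (incidence route) *v link_costs \<tau> (link_flow route h)"

text \<open>
  Link cost functions matter on \<open>[0, \<infinity>)\<close> only, so their derivatives are taken within
  that half-line (one-sided at \<open>0\<close>).
\<close>

definition deriv_nonneg :: "(real \<Rightarrow> real) \<Rightarrow> real \<Rightarrow> real" where
  "deriv_nonneg f x = vector_derivative f (at x within {0..})"

definition C2_nonneg :: "(real \<Rightarrow> real) \<Rightarrow> bool" where
  "C2_nonneg f \<longleftrightarrow>
     (\<exists>f' f''. (\<forall>x\<ge>0. (f has_real_derivative f' x) (at x within {0..})) \<and>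
              (\<forall>x\<ge>0. (f' has_real_derivative f'' x) (at x within {0..})) \<and>
              continuous_on {0..} f'')"

definition admissible_link_costs ::
  "('p::finite \<Rightarrow> 'w) \<Rightarrow> ('w \<Rightarrow> real) \<Rightarrow> ('p \<Rightarrow> 'l::finite list) \<Rightarrow>
   ('l \<Rightarrow> real \<Rightarrow> real) \<Rightarrow> bool" where
  "admissible_link_costs od d route \<tau> \<longleftrightarrow>
     (\<forall>l. (\<forall>x\<ge>0. 0 \<le> \<tau> l x) \<and> C2_nonneg (\<tau> l) \<and> mono_on {0..} (\<tau> l) \<and>
          (\<exists>M. M-lipschitz_on {link_flow route h $ l | h. feasible od d h} (deriv_nonneg (\<tau> l))))"

definition path_costs_jacobian ::
  "('p::finite \<Rightarrow> 'l::finite list) \<Rightarrow> ('l \<Rightarrow> real \<Rightarrow> real) \<Rightarrow> real ^ 'p \<Rightarrow> real ^ 'p ^ 'p" where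
  "path_costs_jacobian route \<tau> h =
     transpose (incidence route)
     ** (\<chi> l m. if l = m then deriv_nonneg (\<tau> l) (link_flow route h $ l) else 0)
     ** incidence route"

definition logit_prob :: "('p::finite \<Rightarrow> 'w) \<Rightarrow> real \<Rightarrow> real ^ 'p \<Rightarrow> real ^ 'p" where
  "logit_prob od \<theta> c =
     (\<chi> i. exp (- \<theta> * c $ i) / (\<Sum>j | od j = od i. exp (- \<theta> * c $ j)))"

definition assign_flow ::
  "('p::finite \<Rightarrow> 'w) \<Rightarrow> real ^ 'p \<Rightarrow> real ^ 'p \<Rightarrow> real ^ 'p" where
  "assign_flow od h p = (\<chi> i. (\<Sum>j | od j = od i. h $ j) * p $ i)"

definition logit_map ::
  "('p::finite \<Rightarrow> 'w) \<Rightarrow> ('p \<Rightarrow> 'l::finite list) \<Rightarrow> ('l \<Rightarrow> real \<Rightarrow> real) \<Rightarrow> real \<Rightarrow>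
   real ^ 'p \<Rightarrow> real ^ 'p" where
  "logit_map od route \<tau> \<theta> h = assign_flow od h (logit_prob od \<theta> (path_costs route \<tau> h))"

definition reduced_jacobian ::
  "('p::finite \<Rightarrow> 'w) \<Rightarrow> ('p \<Rightarrow> 'l::finite list) \<Rightarrow> ('l \<Rightarrow> real \<Rightarrow> real) \<Rightarrow> real \<Rightarrow>
   real ^ 'p \<Rightarrow> real ^ 'p ^ 'p" where
  "reduced_jacobian od route \<tau> \<theta> h =
     (let c = path_costs route \<tau> h in
       jacobian (assign_flow od h) (at (logit_prob od \<theta> c))
       ** jacobian (logit_prob od \<theta>) (at c)
       ** path_costs_jacobian route \<tau> h)"

definition solves_newton ::
  "('p::finite \<Rightarrow> 'w) \<Rightarrow> ('p \<Rightarrow> 'l::finite list) \<Rightarrow> ('l \<Rightarrow> real \<Rightarrow> real) \<Rightarrow> real \<Rightarrow>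
   real ^ 'p \<Rightarrow> real ^ 'p \<Rightarrow> bool" where
  "solves_newton od route \<tau> \<theta> h x \<longleftrightarrow>
     (mat 1 - reduced_jacobian od route \<tau> \<theta> h) *v x = logit_map od route \<tau> \<theta> h - h"

definition newton_step ::
  "('p::finite \<Rightarrow> 'w) \<Rightarrow> ('p \<Rightarrow> 'l::finite list) \<Rightarrow> ('l \<Rightarrow> real \<Rightarrow> real) \<Rightarrow> real \<Rightarrow>
   real ^ 'p \<Rightarrow> real ^ 'p" where
  "newton_step od route \<tau> \<theta> h = (THE x. solves_newton od route \<tau> \<theta> h x)"

definition newton_iter ::
  "('p::finite \<Rightarrow> 'w) \<Rightarrow> ('p \<Rightarrow> 'l::finite list) \<Rightarrow> ('l \<Rightarrow> real \<Rightarrow> real) \<Rightarrow> real \<Rightarrow>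
   real ^ 'p \<Rightarrow> nat \<Rightarrow> real ^ 'p" where
  "newton_iter od route \<tau> \<theta> h0 k = ((\<lambda>h. h + newton_step od route \<tau> \<theta> h) ^^ k) h0"

end

theory Submission
  imports Defs
begin

text \<open>
  On the feasible set the reduced Jacobian acts as \<open>K = - \<theta> A B\<close> with \<open>A\<close> (from the logit
  derivative) and \<open>B\<close> (from the link cost derivatives) symmetric positive semidefinite, so
  \<open>x = K x\<close> forces \<open>0 \<le> x \<bullet> B x = - \<theta> (B x \<bullet> A B x) \<le> 0\<close>, which gives \<open>A B x = 0\<close> and \<open>x = 0\<close>.
  Each column of \<open>A\<close> sums to \<open>0\<close> over every OD pair, hence a Newton step preserves the demand
  constraints.  Finally \<open>(I - K h) (h + \<delta> - hhat) = L h - L hhat - K h (h - hhat)\<close> is a Taylor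
  remainder of the logit map \<open>L\<close>, of second order because the softmax has bounded second
  derivatives and the link costs have Lipschitz derivatives.  Positivity near \<open>hhat\<close> follows
  since \<open>hhat\<close> itself is a positive multiple of logit probabilities.
\<close>

section \<open>Taylor remainders\<close>

text \<open>Apply the mean value inequality to \<open>f z - f' x * z\<close>: its derivative
  \<open>f' z - f' x\<close> is bounded by \<open>M * \<bar>y - x\<bar>\<close> on the segment, and
  the length of the segment is the second factor. The sharp constant would be \<open>M / 2\<close>,
  but only the order matters here.\<close>

lemma taylor_lipschitz_derivative:
  fixes f f' :: "real \<Rightarrow> real"
  assumes S: "convex S"
    and deriv: "\<And>z. z \<in> S \<Longrightarrow> (f has_real_derivative f' z) (at z within S)"
    and lip: "M-lipschitz_on S f'"
    and x: "x \<in> S" and y: "y \<in> S"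
  shows "\<bar>f y - f x - f' x * (y - x)\<bar> \<le> M * (y - x)\<^sup>2"
proof -
  have sub: "closed_segment x y \<subseteq> S"
    by (rule closed_segment_subset[OF x y S])
  have M: "0 \<le> M"
    using lip by (rule lipschitz_on_nonneg)
  have "norm ((f y - f' x * y) - (f x - f' x * x)) \<le> (M * \<bar>y - x\<bar>) * norm (y - x)"
  proof (rule field_differentiable_bound)
    show "convex (closed_segment x y)" "x \<in> closed_segment x y" "y \<in> closed_segment x y"
      by auto
    fix z assume z: "z \<in> closed_segment x y"
    have "(f has_real_derivative f' z) (at z within closed_segment x y)"
      using deriv[of z] z sub by (meson has_field_derivative_subset subsetD)
    then show "((\<lambda>z. f z - f' x * z) has_field_derivative (f' z - f' x))
        (at z within closed_segment x y)"
      by (auto intro!: derivative_eq_intros)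
    have "\<bar>f' z - f' x\<bar> \<le> M * \<bar>z - x\<bar>"
      using lipschitz_onD[OF lip, of z x] z sub x by (auto simp: dist_real_def)
    also have "\<bar>z - x\<bar> \<le> \<bar>y - x\<bar>"
      using segment_bound(1)[OF z] by simp
    then have "M * \<bar>z - x\<bar> \<le> M * \<bar>y - x\<bar>"
      using M by (rule mult_left_mono)
    finally show "norm (f' z - f' x) \<le> M * \<bar>y - x\<bar>"
      by simp
  qed
  moreover have "(f y - f' x * y) - (f x - f' x * x) = f y - f x - f' x * (y - x)"
    by (simp add: algebra_simps)
  moreover have "(M * \<bar>y - x\<bar>) * \<bar>y - x\<bar> = M * (y - x)\<^sup>2"
    by (simp add: power2_eq_square mult.assoc)
  ultimately show ?thesis
    by simp
qed

text \<open>Nontriviality of this filter is what makes derivatives within the half-line unique, also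
  at the endpoint 0. It holds because the half-line contains everything to the right of
  \<open>x\<close>.\<close>

lemma at_within_nonneg_nontrivial:
  fixes x :: real
  assumes "0 \<le> x"
  shows "at x within {0..} \<noteq> bot"
proof -
  have "at_right x \<le> at x within {0..}"
    using assms by (intro at_le) auto
  then show ?thesis
    using trivial_limit_at_right_real[of x] by (metis bot.extremum_uniqueI)
qed

lemma C2_nonneg_has_deriv_nonneg:
  assumes "C2_nonneg f" "0 \<le> x"
  shows "(f has_real_derivative deriv_nonneg f x) (at x within {0..})"
proof -
  from assms obtain D where D: "(f has_real_derivative D) (at x within {0..})"
    unfolding C2_nonneg_def by blast
  then have "deriv_nonneg f x = D"
    unfolding deriv_nonneg_def has_real_derivative_iff_has_vector_derivative
    by (rule vector_derivative_within[OF at_within_nonneg_nontrivial[OF assms(2)]])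
  with D show ?thesis by simp
qed

text \<open>Difference quotients of a monotone function are nonnegative on either side of
  \<open>x\<close>, and the sign passes to the limit.\<close>

lemma mono_on_deriv_nonneg:
  assumes "mono_on {0..} f" "C2_nonneg f" "0 \<le> x"
  shows "0 \<le> deriv_nonneg f x"
proof (rule tendsto_lowerbound)
  show "((\<lambda>y. (f y - f x) / (y - x)) \<longlongrightarrow> deriv_nonneg f x) (at x within {0..})"
    using C2_nonneg_has_deriv_nonneg[OF assms(2,3)] by (simp add: has_field_derivative_iff)
  have "0 \<le> (f y - f x) / (y - x)" if "y \<in> {0..}" for y
  proof (cases "x \<le> y")
    case True
    then have "f x \<le> f y" using assms(3) that by (auto intro: mono_onD[OF assms(1)])
    with True show ?thesis by simp
  next
    case False
    then have "f y \<le> f x" using assms(3) that by (auto intro: mono_onD[OF assms(1)])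
    with False show ?thesis by (simp add: divide_nonpos_nonpos)
  qed
  then show "\<forall>\<^sub>F y in at x within {0..}. 0 \<le> (f y - f x) / (y - x)"
    by (auto simp: eventually_at_filter)
  show "at x within {0..} \<noteq> bot"
    by (rule at_within_nonneg_nontrivial[OF assms(3)])
qed

section \<open>The logit choice probabilities\<close>

text \<open>When \<open>q\<close> holds logit probabilities, this is the expectation of
  \<open>v\<close> under the path choice within one OD pair.\<close>

definition od_mean :: "('p::finite \<Rightarrow> 'w) \<Rightarrow> real ^ 'p \<Rightarrow> real ^ 'p \<Rightarrow> 'w \<Rightarrow> real" where
  "od_mean od q v w = (\<Sum>j | od j = w. q $ j * v $ j)"

text \<open>The differential of the softmax in direction \<open>v\<close>, expressed through the
  probability vector \<open>q\<close> alone. In this centred form its sums over OD pairs visibly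
  vanish, and its quadratic form is a negative multiple of a variance.\<close>

definition logit_diff ::
  "('p::finite \<Rightarrow> 'w) \<Rightarrow> real \<Rightarrow> real ^ 'p \<Rightarrow> real ^ 'p \<Rightarrow> real ^ 'p" where
  "logit_diff od \<theta> q v = (\<chi> i. - \<theta> * q $ i * (v $ i - od_mean od q v (od i)))"

lemma od_mean_diff: "od_mean od q (u - v) w = od_mean od q u w - od_mean od q v w"
  by (simp add: od_mean_def algebra_simps sum_subtractf)

lemma logit_diff_diff: "logit_diff od \<theta> q (u - v) = logit_diff od \<theta> q u - logit_diff od \<theta> q v"
  by (simp add: logit_diff_def vec_eq_iff od_mean_diff algebra_simps)

lemma exp_sum_pos:
  fixes od :: "'p::finite \<Rightarrow> 'w"
  shows "0 < (\<Sum>j | od j = od i. exp (f j :: real))"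
  by (rule sum_pos) auto

lemma logit_prob_pos: "0 < logit_prob od \<theta> c $ i"
  unfolding logit_prob_def vec_lambda_beta by (intro divide_pos_pos exp_sum_pos) simp

text \<open>The range condition excludes OD pairs without paths, for which the empty sum would be
  0.\<close>

lemma logit_prob_sum:
  assumes "w \<in> range od"
  shows "(\<Sum>j | od j = w. logit_prob od \<theta> c $ j) = 1"
proof -
  from assms obtain i where w: "w = od i" by blast
  let ?Z = "\<Sum>j | od j = od i. exp (- \<theta> * c $ j)"
  have "(\<Sum>j | od j = od i. logit_prob od \<theta> c $ j)
      = (\<Sum>j | od j = od i. exp (- \<theta> * c $ j) / ?Z)"
    by (rule sum.cong) (auto simp: logit_prob_def)
  also have "\<dots> = ?Z / ?Z"
    by (simp only: sum_divide_distrib)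
  also have "\<dots> = 1"
    using exp_sum_pos[of "\<lambda>j. - \<theta> * c $ j" od i] by simp
  finally show ?thesis by (simp add: w)
qed

lemma logit_prob_le_1: "logit_prob od \<theta> c $ i \<le> 1"
proof -
  have "logit_prob od \<theta> c $ i \<le> (\<Sum>j | od j = od i. logit_prob od \<theta> c $ j)"
    by (rule member_le_sum) (auto intro: less_imp_le[OF logit_prob_pos])
  then show ?thesis by (simp add: logit_prob_sum)
qed

lemma has_derivative_vecI:
  fixes f :: "'a::real_normed_vector \<Rightarrow> real ^ 'n"
  assumes "\<And>i. ((\<lambda>x. f x $ i) has_derivative (\<lambda>v. f' v $ i)) (at x within S)"
  shows "(f has_derivative f') (at x within S)"
  unfolding has_derivative_componentwise_within[of f f']
  using assms by (auto simp: Basis_vec_def inner_axis)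

lemma logit_prob_has_derivative:
  "(logit_prob od \<theta> has_derivative logit_diff od \<theta> (logit_prob od \<theta> c)) (at c)"
proof (rule has_derivative_vecI)
  fix i
  let ?Z = "\<lambda>c. \<Sum>j | od j = od i. exp (- \<theta> * c $ j)"
  let ?q = "logit_prob od \<theta> c"
  have Z: "?Z c \<noteq> 0"
    using exp_sum_pos[of "\<lambda>j. - \<theta> * c $ j" od i] by simp
  have e: "((\<lambda>c. exp (- \<theta> * c $ j)) has_derivative (\<lambda>v. exp (- \<theta> * c $ j) * (- \<theta> * v $ j))) (at c)" for j
    by (auto intro!: derivative_eq_intros bounded_linear.has_derivative[OF bounded_linear_vec_nth])
  have mean: "od_mean od ?q v (od i) = (\<Sum>j | od j = od i. exp (- \<theta> * c $ j) * v $ j) / ?Z c" for v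
    unfolding od_mean_def sum_divide_distrib
    by (rule sum.cong) (auto simp: logit_prob_def)
  have "((\<lambda>c. exp (- \<theta> * c $ i) / ?Z c) has_derivative
      (\<lambda>v. (exp (- \<theta> * c $ i) * (- \<theta> * v $ i) * ?Z c
          - exp (- \<theta> * c $ i) * (\<Sum>j | od j = od i. exp (- \<theta> * c $ j) * (- \<theta> * v $ j)))
          / (?Z c * ?Z c))) (at c)"
    by (rule has_derivative_divide'[OF e has_derivative_sum[OF e] Z])
  moreover have "(exp (- \<theta> * c $ i) * (- \<theta> * v $ i) * ?Z c
          - exp (- \<theta> * c $ i) * (\<Sum>j | od j = od i. exp (- \<theta> * c $ j) * (- \<theta> * v $ j)))
          / (?Z c * ?Z c) = logit_diff od \<theta> ?q v $ i" for v
  proof -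
    have s: "(\<Sum>j | od j = od i. exp (- \<theta> * c $ j) * (- \<theta> * v $ j))
        = - \<theta> * (\<Sum>j | od j = od i. exp (- \<theta> * c $ j) * v $ j)"
      unfolding sum_distrib_left by (rule sum.cong) auto
    have q: "?q $ i = exp (- \<theta> * c $ i) / ?Z c"
      by (simp add: logit_prob_def)
    \<comment> \<open>The quotient rule, with the exponential sums abstracted to plain reals so that
      they stay intact during field simplification.\<close>
    have alg: "(e * (- \<theta> * y) * z - e * (- \<theta> * m)) / (z * z) = - \<theta> * (e / z) * (y - m / z)"
      if "z \<noteq> 0" for e y z m :: real
      using that by (simp add: field_simps)
    show ?thesis
      unfolding logit_diff_def vec_lambda_beta mean s q by (rule alg[OF Z])
  qed
  ultimately show "((\<lambda>c. logit_prob od \<theta> c $ i) has_derivative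
      (\<lambda>v. logit_diff od \<theta> ?q v $ i)) (at c)"
    by (simp add: logit_prob_def)
qed

text \<open>The mean is a convex combination of entries of \<open>v\<close>, each bounded by the
  norm.\<close>

lemma od_mean_logit_abs_le:
  assumes "w \<in> range od"
  shows "\<bar>od_mean od (logit_prob od \<theta> c) v w\<bar> \<le> norm v"
proof -
  let ?q = "logit_prob od \<theta> c"
  have "\<bar>od_mean od ?q v w\<bar> \<le> (\<Sum>j | od j = w. \<bar>?q $ j * v $ j\<bar>)"
    unfolding od_mean_def by (rule sum_abs)
  also have "\<dots> \<le> (\<Sum>j | od j = w. ?q $ j * norm v)"
    using logit_prob_pos[of od \<theta> c]
    by (intro sum_mono) (simp add: abs_mult less_imp_le mult_left_mono component_le_norm_cart)
  also have "\<dots> = norm v"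
    using logit_prob_sum[OF assms] by (simp flip: sum_distrib_right)
  finally show ?thesis .
qed

text \<open>The factor 2 arises because an entry and the mean are each bounded by the norm. The
  bound is uniform in \<open>c\<close>, since probabilities never exceed 1.\<close>

lemma logit_diff_abs_le:
  assumes "0 \<le> \<theta>"
  shows "\<bar>logit_diff od \<theta> (logit_prob od \<theta> c) v $ i\<bar> \<le> 2 * \<theta> * norm v"
proof -
  let ?q = "logit_prob od \<theta> c"
  have "\<bar>v $ i - od_mean od ?q v (od i)\<bar> \<le> 2 * norm v"
    using od_mean_logit_abs_le[of "od i" od \<theta> c v] component_le_norm_cart[of v i] by auto
  then have "?q $ i * \<bar>v $ i - od_mean od ?q v (od i)\<bar> \<le> 1 * (2 * norm v)"
    by (intro mult_mono logit_prob_le_1) (auto intro: less_imp_le logit_prob_pos)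
  then have "\<theta> * (?q $ i * \<bar>v $ i - od_mean od ?q v (od i)\<bar>) \<le> \<theta> * (1 * (2 * norm v))"
    using assms by (rule mult_left_mono)
  then show ?thesis
    using assms logit_prob_pos[of od \<theta> c i]
    by (simp add: logit_diff_def abs_mult mult_ac)
qed

text \<open>On the line from \<open>c\<close> to \<open>c + v\<close> the problem is
  one-dimensional, and the scalar Taylor bound applies between times 0 and 1 once the derivative
  along the line is shown to be Lipschitz. The constant does not depend on \<open>c\<close>.\<close>

lemma logit_prob_taylor:
  fixes c v :: "real ^ 'p::finite"
  assumes "0 \<le> \<theta>"
  shows "\<bar>logit_prob od \<theta> (c + v) $ i - logit_prob od \<theta> c $ i
            - logit_diff od \<theta> (logit_prob od \<theta> c) v $ i\<bar>
      \<le> \<theta>\<^sup>2 * (4 + 2 * CARD('p)) * (norm v)\<^sup>2"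
proof -
  define p where "p t = logit_prob od \<theta> (c + t *\<^sub>R v)" for t
  define \<phi>' where "\<phi>' j t = logit_diff od \<theta> (p t) v $ j" for j t
  have deriv: "((\<lambda>t. p t $ j) has_real_derivative \<phi>' j t) (at t within S)" for j t S
  proof -
    have "((\<lambda>t. c + t *\<^sub>R v) has_derivative (\<lambda>s. s *\<^sub>R v)) (at t within S)"
      by (auto intro!: derivative_eq_intros)
    from has_derivative_compose[OF this logit_prob_has_derivative[of od \<theta>]]
    have "(p has_derivative (\<lambda>s. logit_diff od \<theta> (p t) (s *\<^sub>R v))) (at t within S)"
      by (simp add: p_def[abs_def])
    then have "((\<lambda>t. p t $ j) has_derivative (\<lambda>s. logit_diff od \<theta> (p t) (s *\<^sub>R v) $ j)) (at t within S)"
      by (rule bounded_linear.has_derivative[OF bounded_linear_vec_nth])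
    moreover have "logit_diff od \<theta> (p t) (s *\<^sub>R v) $ j = \<phi>' j t * s" for s
      by (simp add: \<phi>'_def logit_diff_def od_mean_def algebra_simps sum_distrib_left)
    ultimately show ?thesis
      by (simp add: has_field_derivative_def)
  qed
  have plip: "\<bar>p s $ j - p t $ j\<bar> \<le> 2 * \<theta> * norm v * \<bar>s - t\<bar>" for s t j
  proof -
    have "norm (p s $ j - p t $ j) \<le> (2 * \<theta> * norm v) * norm (s - t)"
      by (rule field_differentiable_bound[OF convex_UNIV deriv])
        (auto simp: \<phi>'_def p_def logit_diff_abs_le assms)
    then show ?thesis by simp
  qed
  \<comment> \<open>The derivative is \<open>- \<theta>\<close> times a probability times a
    deviation from the mean. Changing the probability costs \<open>?D * 2 * norm v\<close>; changing
    the mean costs at most \<open>?D * norm v\<close> for each of the \<open>CARD('p)\<close> paths.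
    With the \<open>2 * \<theta>\<close> inside \<open>?D\<close> this gives the stated
    constant.\<close>
  have lip: "(\<theta>\<^sup>2 * (4 + 2 * CARD('p)) * (norm v)\<^sup>2)-lipschitz_on {0..1} (\<phi>' i)"
  proof (rule lipschitz_onI)
    fix s t :: real
    let ?m = "\<lambda>t. od_mean od (p t) v (od i)"
    let ?D = "2 * \<theta> * norm v * \<bar>s - t\<bar>"
    have D: "0 \<le> ?D" using assms by simp
    have "\<bar>?m t - ?m s\<bar> \<le> (\<Sum>j | od j = od i. \<bar>(p t $ j - p s $ j) * v $ j\<bar>)"
      unfolding od_mean_def sum_subtractf[symmetric] left_diff_distrib[symmetric] by (rule sum_abs)
    also have "\<dots> \<le> (\<Sum>j | od j = od i. ?D * norm v)"
      unfolding abs_mult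
      by (intro sum_mono mult_mono component_le_norm_cart D)
        (use plip[of t _ s] in \<open>auto simp: abs_minus_commute\<close>)
    also have "\<dots> \<le> (\<Sum>j\<in>(UNIV::'p set). ?D * norm v)"
      using D by (intro sum_mono2) auto
    finally have m: "\<bar>?m t - ?m s\<bar> \<le> CARD('p) * (?D * norm v)" by simp
    have "\<bar>v $ i - ?m s\<bar> \<le> 2 * norm v"
      using od_mean_logit_abs_le[of "od i" od \<theta> "c + s *\<^sub>R v" v] component_le_norm_cart[of v i]
      by (auto simp: p_def)
    then have "\<bar>p s $ i - p t $ i\<bar> * \<bar>v $ i - ?m s\<bar> \<le> ?D * (2 * norm v)"
      by (intro mult_mono plip D) auto
    moreover have "\<bar>p t $ i\<bar> * \<bar>?m t - ?m s\<bar> \<le> 1 * (CARD('p) * (?D * norm v))"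
      using logit_prob_pos[of od \<theta> "c + t *\<^sub>R v" i] logit_prob_le_1[of od \<theta> "c + t *\<^sub>R v" i] m
      by (intro mult_mono) (auto simp: p_def)
    moreover have "p s $ i * (v $ i - ?m s) - p t $ i * (v $ i - ?m t)
        = (p s $ i - p t $ i) * (v $ i - ?m s) + p t $ i * (?m t - ?m s)"
      by (simp add: algebra_simps)
    ultimately have "\<bar>p s $ i * (v $ i - ?m s) - p t $ i * (v $ i - ?m t)\<bar>
        \<le> ?D * (2 * norm v) + CARD('p) * (?D * norm v)"
      using abs_triangle_ineq[of "(p s $ i - p t $ i) * (v $ i - ?m s)" "p t $ i * (?m t - ?m s)"]
      by (simp add: abs_mult)
    then have "\<theta> * \<bar>p s $ i * (v $ i - ?m s) - p t $ i * (v $ i - ?m t)\<bar>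
        \<le> \<theta> * (?D * (2 * norm v) + CARD('p) * (?D * norm v))"
      using assms by (rule mult_left_mono)
    moreover have "\<phi>' i s - \<phi>' i t = - \<theta> * (p s $ i * (v $ i - ?m s) - p t $ i * (v $ i - ?m t))"
      by (simp add: \<phi>'_def logit_diff_def algebra_simps)
    then have "\<bar>\<phi>' i s - \<phi>' i t\<bar> = \<theta> * \<bar>p s $ i * (v $ i - ?m s) - p t $ i * (v $ i - ?m t)\<bar>"
      using assms by (simp only: abs_mult) simp
    moreover have "\<theta> * (?D * (2 * norm v) + CARD('p) * (?D * norm v))
        = \<theta>\<^sup>2 * (4 + 2 * CARD('p)) * (norm v)\<^sup>2 * dist s t"
      by (simp add: dist_real_def algebra_simps power2_eq_square)
    ultimately show "dist (\<phi>' i s) (\<phi>' i t)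
        \<le> \<theta>\<^sup>2 * (4 + 2 * CARD('p)) * (norm v)\<^sup>2 * dist s t"
      by (simp only: dist_real_def)
  qed simp
  have "\<bar>p 1 $ i - p 0 $ i - \<phi>' i 0 * (1 - 0)\<bar> \<le> \<theta>\<^sup>2 * (4 + 2 * CARD('p)) * (norm v)\<^sup>2 * (1 - 0)\<^sup>2"
    by (rule taylor_lipschitz_derivative[OF _ deriv lip]) auto
  then show ?thesis by (simp add: p_def \<phi>'_def)
qed

section \<open>The reduced Newton system\<close>

text \<open>Replaces the abstract matrices in \<open>reduced_jacobian\<close> by explicit
  differentials.\<close>

lemma jacobian_mult:
  fixes f :: "real ^ 'n \<Rightarrow> real ^ 'm"
  assumes "(f has_derivative f') (at x)"
  shows "jacobian f (at x) *v v = f' v"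
proof -
  have "(f has_derivative (*v) (jacobian f (at x))) (at x)"
    using assms jacobian_works[of f "at x"] by (auto simp: differentiable_def)
  then show ?thesis
    using has_derivative_unique[OF _ assms] by metis
qed

text \<open>The map is linear in \<open>p\<close> for fixed \<open>h\<close>, hence its own
  derivative.\<close>

lemma assign_flow_has_derivative:
  "(assign_flow od h has_derivative assign_flow od h) (at p)"
  by (rule has_derivative_vecI)
    (auto simp: assign_flow_def
      intro!: derivative_eq_intros bounded_linear.has_derivative[OF bounded_linear_vec_nth])

text \<open>Later arguments use the reduced Jacobian only through this action on vectors.\<close>

lemma reduced_jacobian_mult:
  "reduced_jacobian od route \<tau> \<theta> h *v x =
     assign_flow od h (logit_diff od \<theta> (logit_prob od \<theta> (path_costs route \<tau> h))
       (path_costs_jacobian route \<tau> h *v x))"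
  unfolding reduced_jacobian_def Let_def
  by (simp add: jacobian_mult[OF assign_flow_has_derivative]
      jacobian_mult[OF logit_prob_has_derivative] flip: matrix_vector_mul_assoc)

lemma diagonal_matrix_mult:
  fixes t :: "'l::finite \<Rightarrow> real"
  shows "(\<chi> l m. if l = m then t l else 0) *v z = (\<chi> l. t l * z $ l)"
  by (simp add: matrix_vector_mult_def vec_eq_iff if_distrib[of "\<lambda>t. t * _"] cong: if_cong)

lemma path_costs_jacobian_mult:
  "path_costs_jacobian route \<tau> h *v x = transpose (incidence route) *v
     (\<chi> l. deriv_nonneg (\<tau> l) (link_flow route h $ l) * link_flow route x $ l)"
  by (simp only: path_costs_jacobian_def link_flow_def diagonal_matrix_mult
      matrix_vector_mul_assoc[symmetric])

lemma feasible_assign_flow: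
  assumes "feasible od d h"
  shows "assign_flow od h p $ i = d (od i) * p $ i"
  using assms by (simp add: assign_flow_def feasible_def)

lemma sum_by_od:
  fixes od :: "'p::finite \<Rightarrow> 'w::finite" and f :: "'p \<Rightarrow> real"
  shows "(\<Sum>i\<in>UNIV. f i) = (\<Sum>w\<in>UNIV. \<Sum>i | od i = w. f i)"
  using sum.group[of "UNIV :: 'p set" "UNIV :: 'w set" od f] by simp

lemma link_flow_diff: "link_flow route (g - h) = link_flow route g - link_flow route h"
  by (simp add: link_flow_def matrix_vector_mult_diff_distrib)

lemma linear_link_flow: "linear (\<lambda>h. link_flow route h $ l)"
  using linear_compose[OF matrix_vector_mul_linear bounded_linear.linear[OF bounded_linear_vec_nth]]
  by (simp add: link_flow_def comp_def)

lemma continuous_on_link_flow [continuous_intros]: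
  "continuous_on S f \<Longrightarrow> continuous_on S (\<lambda>x. link_flow route (f x) $ l)"
  using continuous_on_compose2[OF linear_continuous_on[of "\<lambda>h. link_flow route h $ l" UNIV]]
    linear_link_flow by (metis linear_conv_bounded_linear subset_UNIV)

lemma link_flow_bound: "\<exists>B\<ge>0. \<forall>x. \<bar>link_flow route x $ l\<bar> \<le> B * norm x"
  using linear_bounded_pos[OF linear_link_flow[where l = l]] by (metis less_imp_le real_norm_def)

text \<open>Reduces vector estimates to components: the Euclidean norm is at most the sum of the
  absolute entries, so the component constants can be added up.\<close>

lemma vec_bound_exI:
  fixes f :: "'a \<Rightarrow> 'b \<Rightarrow> real ^ 'n"
  assumes "\<And>i. \<exists>C. \<forall>x\<in>A. \<forall>y\<in>B. \<bar>f x y $ i\<bar> \<le> C * b x y"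
  shows "\<exists>C. \<forall>x\<in>A. \<forall>y\<in>B. norm (f x y) \<le> C * b x y"
proof -
  obtain C where C: "\<And>i x y. x \<in> A \<Longrightarrow> y \<in> B \<Longrightarrow> \<bar>f x y $ i\<bar> \<le> C i * b x y"
    using assms by metis
  have "norm (f x y) \<le> (\<Sum>i\<in>UNIV. C i) * b x y" if "x \<in> A" "y \<in> B" for x y
    unfolding sum_distrib_right
    by (rule order_trans[OF norm_le_l1_cart]) (intro sum_mono C that)
  then show ?thesis by blast
qed

locale logit_network =
  fixes od :: "'p::finite \<Rightarrow> 'w::finite"
    and d :: "'w \<Rightarrow> real"
    and route :: "'p \<Rightarrow> 'l::finite list"
    and \<tau> :: "'l \<Rightarrow> real \<Rightarrow> real"
    and \<theta> :: real
  assumes surj_od: "surj od"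
    and demand_pos: "0 < d w"
    and costs: "admissible_link_costs od d route \<tau>"
    and theta_pos: "0 < \<theta>"
begin

abbreviation "F \<equiv> {h. feasible od d h}"
abbreviation "flow_range l \<equiv> (\<lambda>h. link_flow route h $ l) ` F"
abbreviation "prob h \<equiv> logit_prob od \<theta> (path_costs route \<tau> h)"
abbreviation "K h \<equiv> reduced_jacobian od route \<tau> \<theta> h"
abbreviation "L h \<equiv> logit_map od route \<tau> \<theta> h"

section \<open>The feasible set and the ranges of link flows\<close>

lemma compact_feasible: "compact F"
proof -
  have "F = {h. \<forall>i. 0 \<le> h $ i} \<inter> {h. \<forall>w. (\<Sum>i | od i = w. h $ i) = d w}"
    by (auto simp: feasible_def)
  then have "closed F"
    by (auto intro!: closed_Collect_all closed_Collect_le closed_Collect_eq continuous_intros)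
  moreover have "norm h \<le> (\<Sum>i\<in>UNIV. d (od i))" if "h \<in> F" for h
  proof (rule order_trans[OF norm_le_l1_cart sum_mono])
    fix i
    have "h $ i \<le> (\<Sum>j | od j = od i. h $ j)"
      using that by (intro member_le_sum) (auto simp: feasible_def)
    then show "\<bar>h $ i\<bar> \<le> d (od i)"
      using that by (simp add: feasible_def)
  qed
  then have "bounded F"
    unfolding bounded_iff by blast
  ultimately show ?thesis
    by (simp add: compact_eq_bounded_closed)
qed

text \<open>Convexity is inherited by the range of flows on each link, where the mean value and
  Taylor bounds need it.\<close>

lemma convex_feasible: "convex F"
proof (rule convexI)
  fix g h :: "real ^ 'p" and u v :: real
  assume *: "g \<in> F" "h \<in> F" "0 \<le> u" "0 \<le> v" "u + v = 1"
  have "(\<Sum>i | od i = w. u * g $ i + v * h $ i) = d w" for w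
  proof -
    have "(\<Sum>i | od i = w. u * g $ i + v * h $ i) = u * d w + v * d w"
      using * by (simp add: sum.distrib feasible_def flip: sum_distrib_left)
    also have "\<dots> = d w"
      using * by (simp flip: distrib_right)
    finally show ?thesis .
  qed
  with * show "u *\<^sub>R g + v *\<^sub>R h \<in> F"
    by (auto simp: feasible_def)
qed

lemma compact_flow_range: "compact (flow_range l)"
  by (intro compact_continuous_image compact_feasible continuous_intros)

lemma convex_flow_range: "convex (flow_range l)"
  by (intro convex_linear_image linear_link_flow convex_feasible)

lemma flow_range_nonneg: "flow_range l \<subseteq> {0..}"
  by (auto simp: feasible_def link_flow_def matrix_vector_mult_def incidence_def intro!: sum_nonneg)

section \<open>Lipschitz and Taylor bounds for link and path costs\<close>

lemma deriv_lipschitz: "\<exists>M. M-lipschitz_on (flow_range l) (deriv_nonneg (\<tau> l))"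
proof -
  have "{link_flow route h $ l | h. feasible od d h} = flow_range l" by auto
  moreover have "\<exists>M. M-lipschitz_on {link_flow route h $ l | h. feasible od d h} (deriv_nonneg (\<tau> l))"
    using costs unfolding admissible_link_costs_def by blast
  ultimately show ?thesis by simp
qed

lemma link_cost_deriv:
  assumes "x \<in> flow_range l"
  shows "(\<tau> l has_real_derivative deriv_nonneg (\<tau> l) x) (at x within flow_range l)"
  using C2_nonneg_has_deriv_nonneg[of "\<tau> l" x] costs assms flow_range_nonneg[of l]
  by (meson admissible_link_costs_def atLeast_iff has_field_derivative_subset subsetD)

lemma link_cost_deriv_nonneg:
  assumes "x \<in> flow_range l"
  shows "0 \<le> deriv_nonneg (\<tau> l) x"
  using mono_on_deriv_nonneg[of "\<tau> l" x] costs assms flow_range_nonneg[of l]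
  by (meson admissible_link_costs_def atLeast_iff subsetD)

lemma continuous_on_deriv: "continuous_on (flow_range l) (deriv_nonneg (\<tau> l))"
  using deriv_lipschitz lipschitz_on_continuous_on by blast

lemma continuous_on_link_cost: "continuous_on (flow_range l) (\<tau> l)"
  using link_cost_deriv by (meson DERIV_continuous continuous_on_eq_continuous_within)

text \<open>The derivative is continuous on a compact range, hence bounded there.\<close>

lemma link_cost_lipschitz:
  "\<exists>B. \<forall>x\<in>flow_range l. \<forall>y\<in>flow_range l. \<bar>\<tau> l y - \<tau> l x\<bar> \<le> B * \<bar>y - x\<bar>"
proof -
  have "bounded (deriv_nonneg (\<tau> l) ` flow_range l)"
    by (intro compact_imp_bounded compact_continuous_image continuous_on_deriv compact_flow_range)
  then obtain B where "\<And>x. x \<in> flow_range l \<Longrightarrow> norm (deriv_nonneg (\<tau> l) x) \<le> B"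
    unfolding bounded_iff by blast
  then show ?thesis
    using field_differentiable_bound[OF convex_flow_range link_cost_deriv]
    by (metis real_norm_def)
qed

lemma path_costs_lipschitz:
  "\<exists>B. \<forall>g\<in>F. \<forall>h\<in>F. norm (path_costs route \<tau> g - path_costs route \<tau> h) \<le> B * norm (g - h)"
proof -
  have "\<exists>B. \<forall>g\<in>F. \<forall>h\<in>F. norm (link_costs \<tau> (link_flow route g) - link_costs \<tau> (link_flow route h))
      \<le> B * norm (g - h)"
  proof (rule vec_bound_exI)
    fix l
    obtain A where A: "\<forall>x\<in>flow_range l. \<forall>y\<in>flow_range l. \<bar>\<tau> l y - \<tau> l x\<bar> \<le> A * \<bar>y - x\<bar>"
      using link_cost_lipschitz by blast
    obtain B where B: "\<And>x. \<bar>link_flow route x $ l\<bar> \<le> B * norm x"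
      using link_flow_bound by metis
    \<comment> \<open>The sign of \<open>A\<close> is unknown, so its absolute value enters the
      product with \<open>B\<close>.\<close>
    have "\<bar>\<tau> l (link_flow route g $ l) - \<tau> l (link_flow route h $ l)\<bar> \<le> (\<bar>A\<bar> * B) * norm (g - h)"
      if "g \<in> F" "h \<in> F" for g h
    proof -
      have "\<bar>\<tau> l (link_flow route g $ l) - \<tau> l (link_flow route h $ l)\<bar>
          \<le> A * \<bar>link_flow route g $ l - link_flow route h $ l\<bar>"
        using A that by auto
      also have "\<dots> \<le> \<bar>A\<bar> * \<bar>link_flow route g $ l - link_flow route h $ l\<bar>"
        by (intro mult_right_mono) auto
      also have "\<dots> \<le> \<bar>A\<bar> * (B * norm (g - h))"
        using B[of "g - h"] by (intro mult_left_mono) (auto simp: link_flow_diff)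
      finally show ?thesis by simp
    qed
    then show "\<exists>C. \<forall>g\<in>F. \<forall>h\<in>F. \<bar>(link_costs \<tau> (link_flow route g) - link_costs \<tau> (link_flow route h)) $ l\<bar>
        \<le> C * norm (g - h)"
      unfolding link_costs_def vector_minus_component vec_lambda_beta by blast
  qed
  then obtain B where B: "\<And>g h. g \<in> F \<Longrightarrow> h \<in> F \<Longrightarrow>
      norm (link_costs \<tau> (link_flow route g) - link_costs \<tau> (link_flow route h)) \<le> B * norm (g - h)"
    by blast
  obtain D where D: "D \<ge> 0" "\<And>r. norm (transpose (incidence route) *v r) \<le> D * norm r"
    using linear_bounded_pos[OF matrix_vector_mul_linear[of "transpose (incidence route)"]]
    by (metis less_imp_le)
  have "norm (path_costs route \<tau> g - path_costs route \<tau> h) \<le> (D * B) * norm (g - h)"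
    if "g \<in> F" "h \<in> F" for g h
  proof -
    have "norm (path_costs route \<tau> g - path_costs route \<tau> h)
        \<le> D * norm (link_costs \<tau> (link_flow route g) - link_costs \<tau> (link_flow route h))"
      unfolding path_costs_def matrix_vector_mult_diff_distrib[symmetric] by (rule D(2))
    also have "\<dots> \<le> D * (B * norm (g - h))"
      by (intro mult_left_mono B that D(1))
    finally show ?thesis by simp
  qed
  then show ?thesis by blast
qed

text \<open>The path cost remainder is the transposed incidence matrix applied to the vector of
  scalar link remainders, so it inherits their quadratic order.\<close>

lemma path_costs_taylor:
  "\<exists>B. \<forall>g\<in>F. \<forall>h\<in>F. norm (path_costs route \<tau> g - path_costs route \<tau> h
      - path_costs_jacobian route \<tau> h *v (g - h)) \<le> B * (norm (g - h))\<^sup>2"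
proof -
  let ?r = "\<lambda>g h. link_costs \<tau> (link_flow route g) - link_costs \<tau> (link_flow route h)
      - (\<chi> l. deriv_nonneg (\<tau> l) (link_flow route h $ l) * link_flow route (g - h) $ l)"
  have "\<exists>B. \<forall>g\<in>F. \<forall>h\<in>F. norm (?r g h) \<le> B * (norm (g - h))\<^sup>2"
  proof (rule vec_bound_exI)
    fix l
    obtain M where M: "M-lipschitz_on (flow_range l) (deriv_nonneg (\<tau> l))"
      using deriv_lipschitz by blast
    obtain B where B: "B \<ge> 0" "\<And>x. \<bar>link_flow route x $ l\<bar> \<le> B * norm x"
      using link_flow_bound by metis
    have "\<bar>?r g h $ l\<bar> \<le> (M * B\<^sup>2) * (norm (g - h))\<^sup>2"
      if "g \<in> F" "h \<in> F" for g h
    proof -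
      have "\<bar>?r g h $ l\<bar> \<le> M * (link_flow route g $ l - link_flow route h $ l)\<^sup>2"
        using taylor_lipschitz_derivative[OF convex_flow_range link_cost_deriv M] that
        by (simp add: link_costs_def link_flow_diff)
      also have "(link_flow route g $ l - link_flow route h $ l)\<^sup>2 \<le> (B * norm (g - h))\<^sup>2"
        using B(2)[of "g - h"] by (intro abs_le_square_iff[THEN iffD1]) (use B in \<open>auto simp: link_flow_diff\<close>)
      finally show ?thesis
        using lipschitz_on_nonneg[OF M] by (simp add: power_mult_distrib mult_left_mono mult.assoc)
    qed
    then show "\<exists>C. \<forall>g\<in>F. \<forall>h\<in>F. \<bar>?r g h $ l\<bar> \<le> C * (norm (g - h))\<^sup>2"
      by blast
  qed
  then obtain B where B: "\<And>g h. g \<in> F \<Longrightarrow> h \<in> F \<Longrightarrow> norm (?r g h) \<le> B * (norm (g - h))\<^sup>2"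
    by blast
  obtain D where D: "D \<ge> 0" "\<And>r. norm (transpose (incidence route) *v r) \<le> D * norm r"
    using linear_bounded_pos[OF matrix_vector_mul_linear[of "transpose (incidence route)"]]
    by (metis less_imp_le)
  have "norm (path_costs route \<tau> g - path_costs route \<tau> h - path_costs_jacobian route \<tau> h *v (g - h))
      \<le> (D * B) * (norm (g - h))\<^sup>2"
    if "g \<in> F" "h \<in> F" for g h
  proof -
    have "norm (path_costs route \<tau> g - path_costs route \<tau> h - path_costs_jacobian route \<tau> h *v (g - h))
        \<le> D * norm (?r g h)"
      unfolding path_costs_def path_costs_jacobian_mult matrix_vector_mult_diff_distrib[symmetric]
      by (rule D(2))
    also have "\<dots> \<le> D * (B * (norm (g - h))\<^sup>2)"
      by (intro mult_left_mono B that D(1))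
    finally show ?thesis by simp
  qed
  then show ?thesis by blast
qed

section \<open>Expansion of the logit map on the feasible set\<close>

lemma K_mult_component:
  assumes "feasible od d h"
  shows "(K h *v x) $ i = d (od i) * logit_diff od \<theta> (prob h) (path_costs_jacobian route \<tau> h *v x) $ i"
  by (simp add: reduced_jacobian_mult feasible_assign_flow[OF assms])

lemma L_component:
  assumes "feasible od d h"
  shows "L h $ i = d (od i) * prob h $ i"
  by (simp add: logit_map_def feasible_assign_flow[OF assms])

lemma od_sum_L:
  assumes "feasible od d h"
  shows "(\<Sum>i | od i = w. L h $ i) = d w"
proof -
  have "(\<Sum>i | od i = w. L h $ i) = (\<Sum>i | od i = w. d w * prob h $ i)"
    by (rule sum.cong) (auto simp: L_component[OF assms])
  \<comment> \<open>Surjectivity of \<open>od\<close> gives every OD pair a path, so its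
    probabilities sum to 1.\<close>
  also have "\<dots> = d w"
    using logit_prob_sum[of w od] surj_od by (simp flip: sum_distrib_left)
  finally show ?thesis .
qed

text \<open>Probability-weighted deviations from the mean cancel. This is why Newton steps preserve
  demands, and it is used again to show that the Newton matrix has trivial kernel.\<close>

lemma od_sum_logit_diff:
  "(\<Sum>i | od i = w. d (od i) * logit_diff od \<theta> (prob h) y $ i) = 0"
proof -
  let ?m = "od_mean od (prob h) y w"
  have "(\<Sum>i | od i = w. d (od i) * logit_diff od \<theta> (prob h) y $ i)
      = (\<Sum>i | od i = w. - d w * \<theta> * (prob h $ i * y $ i) + d w * \<theta> * ?m * prob h $ i)"
    by (rule sum.cong) (auto simp: logit_diff_def algebra_simps)
  also have "\<dots> = - d w * \<theta> * ?m + d w * \<theta> * ?m * (\<Sum>i | od i = w. prob h $ i)"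
    unfolding sum.distrib sum_distrib_left[symmetric] od_mean_def ..
  also have "\<dots> = 0"
    using logit_prob_sum[of w od] surj_od by simp
  finally show ?thesis .
qed

text \<open>The remainder has two sources: the softmax remainder for the cost increment
  \<open>?v\<close>, and the softmax differential applied to the path cost remainder
  \<open>?v - ?y\<close>. The first is quadratic because costs are Lipschitz, the second because the
  cost remainder is quadratic already.\<close>

lemma logit_map_taylor:
  "\<exists>C\<ge>0. \<forall>g\<in>F. \<forall>h\<in>F. norm (L g - L h - K h *v (g - h)) \<le> C * (norm (g - h))\<^sup>2"
proof -
  obtain B1 where B1: "\<And>g h. g \<in> F \<Longrightarrow> h \<in> F \<Longrightarrow>
      norm (path_costs route \<tau> g - path_costs route \<tau> h) \<le> B1 * norm (g - h)"
    using path_costs_lipschitz by metis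
  obtain B2 where B2: "\<And>g h. g \<in> F \<Longrightarrow> h \<in> F \<Longrightarrow>
      norm (path_costs route \<tau> g - path_costs route \<tau> h - path_costs_jacobian route \<tau> h *v (g - h))
      \<le> B2 * (norm (g - h))\<^sup>2"
    using path_costs_taylor by metis
  define A where "A = \<theta>\<^sup>2 * (4 + 2 * CARD('p))"
  have "\<exists>C. \<forall>g\<in>F. \<forall>h\<in>F. norm (L g - L h - K h *v (g - h)) \<le> C * (norm (g - h))\<^sup>2"
  proof (rule vec_bound_exI)
    fix i
    let ?C = "d (od i) * (A * B1\<^sup>2 + 2 * \<theta> * B2)"
    have "\<bar>(L g - L h - K h *v (g - h)) $ i\<bar> \<le> ?C * (norm (g - h))\<^sup>2"
      if g: "g \<in> F" and h: "h \<in> F" for g h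
    proof -
      let ?v = "path_costs route \<tau> g - path_costs route \<tau> h"
      let ?y = "path_costs_jacobian route \<tau> h *v (g - h)"
      let ?d = "logit_diff od \<theta> (prob h)"
      have "\<bar>prob g $ i - prob h $ i - ?d ?v $ i\<bar> \<le> A * (norm ?v)\<^sup>2"
        using logit_prob_taylor[of \<theta> od "path_costs route \<tau> h" ?v i] theta_pos by (simp add: A_def)
      also have "\<dots> \<le> A * (B1 * norm (g - h))\<^sup>2"
        using B1[OF g h] by (intro mult_left_mono power_mono) (auto simp: A_def)
      finally have 1: "\<bar>prob g $ i - prob h $ i - ?d ?v $ i\<bar> \<le> A * B1\<^sup>2 * (norm (g - h))\<^sup>2"
        by (simp add: power_mult_distrib)
      have "\<bar>?d (?v - ?y) $ i\<bar> \<le> 2 * \<theta> * norm (?v - ?y)"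
        using theta_pos by (intro logit_diff_abs_le) simp
      also have "\<dots> \<le> 2 * \<theta> * (B2 * (norm (g - h))\<^sup>2)"
        using theta_pos by (intro mult_left_mono B2 g h) auto
      finally have 2: "\<bar>?d (?v - ?y) $ i\<bar> \<le> 2 * \<theta> * B2 * (norm (g - h))\<^sup>2"
        by simp
      have "(L g - L h - K h *v (g - h)) $ i
          = d (od i) * ((prob g $ i - prob h $ i - ?d ?v $ i) + ?d (?v - ?y) $ i)"
        using g h
        by (simp only: mem_Collect_eq vector_minus_component L_component K_mult_component
            logit_diff_diff[of od \<theta> "prob h" ?v]) (simp add: algebra_simps)
      moreover have "\<bar>(prob g $ i - prob h $ i - ?d ?v $ i) + ?d (?v - ?y) $ i\<bar>
          \<le> (A * B1\<^sup>2 + 2 * \<theta> * B2) * (norm (g - h))\<^sup>2"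
        using 1 2 unfolding distrib_right by linarith
      ultimately show ?thesis
        using demand_pos[of "od i"] by (simp add: abs_mult mult.assoc del: vector_minus_component)
    qed
    then show "\<exists>C. \<forall>g\<in>F. \<forall>h\<in>F. \<bar>(L g - L h - K h *v (g - h)) $ i\<bar> \<le> C * (norm (g - h))\<^sup>2"
      by blast
  qed
  then obtain C where "\<And>g h. g \<in> F \<Longrightarrow> h \<in> F \<Longrightarrow>
      norm (L g - L h - K h *v (g - h)) \<le> C * (norm (g - h))\<^sup>2"
    by blast
  then have "norm (L g - L h - K h *v (g - h)) \<le> \<bar>C\<bar> * (norm (g - h))\<^sup>2"
    if "g \<in> F" "h \<in> F" for g h
    using that by (meson abs_ge_self mult_right_mono order_trans zero_le_power2)
  then show ?thesis
    by (intro exI[of _ "\<bar>C\<bar>"]) auto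
qed

section \<open>Invertibility of the Newton matrix, uniformly over feasible flows\<close>

lemma newton_matrix_kernel:
  assumes h: "feasible od d h" and x: "(mat 1 - K h) *v x = 0"
  shows "x = 0"
proof -
  define y where "y = path_costs_jacobian route \<tau> h *v x"
  define m where "m w = od_mean od (prob h) y w" for w
  have "x = K h *v x"
    using x by (simp add: matrix_vector_mult_diff_rdistrib)
  then have xi: "x $ i = d (od i) * logit_diff od \<theta> (prob h) y $ i" for i
    using K_mult_component[OF h, of x i] by (simp add: y_def)
  \<comment> \<open>Moving the transposed incidence matrix to the other factor exposes a diagonal
    quadratic form in the link flows of \<open>x\<close>.\<close>
  have "x \<bullet> y = (\<Sum>l\<in>UNIV. deriv_nonneg (\<tau> l) (link_flow route h $ l) * (link_flow route x $ l)\<^sup>2)"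
  proof -
    have "x \<bullet> y = link_flow route x \<bullet>
        (\<chi> l. deriv_nonneg (\<tau> l) (link_flow route h $ l) * link_flow route x $ l)"
      unfolding y_def path_costs_jacobian_mult link_flow_def
      by (simp only: transpose_matrix_vector dot_lmul_matrix inner_commute[of x])
        (rule inner_commute)
    then show ?thesis
      by (simp add: inner_vec_def power2_eq_square mult_ac)
  qed
  also have "\<dots> \<ge> 0"
    using h by (intro sum_nonneg mult_nonneg_nonneg link_cost_deriv_nonneg) auto
  finally have xy: "0 \<le> x \<bullet> y" .
  \<comment> \<open>Since \<open>x\<close> lies in the image of \<open>K h\<close>, it sums to 0
    over each OD pair. Hence \<open>y\<close> may be centred by its OD means without changing the
    inner product with \<open>x\<close>, which becomes minus a weighted sum of squares.\<close>
  have "(\<Sum>i\<in>UNIV. x $ i * m (od i)) = (\<Sum>w\<in>UNIV. (\<Sum>i | od i = w. x $ i) * m w)"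
    unfolding sum_by_od[where od = od] sum_distrib_right by (intro sum.cong) auto
  also have "\<dots> = 0"
    using od_sum_logit_diff by (simp add: xi)
  finally have "x \<bullet> y = (\<Sum>i\<in>UNIV. x $ i * (y $ i - m (od i)))"
    by (simp add: inner_vec_def right_diff_distrib sum_subtractf)
  also have "\<dots> = - (\<Sum>i\<in>UNIV. d (od i) * \<theta> * prob h $ i * (y $ i - m (od i))\<^sup>2)"
    unfolding sum_negf[symmetric]
    by (rule sum.cong) (auto simp: xi logit_diff_def m_def power2_eq_square)
  finally have "(\<Sum>i\<in>UNIV. d (od i) * \<theta> * prob h $ i * (y $ i - m (od i))\<^sup>2) \<le> 0"
    using xy by simp
  moreover have pos: "0 < d (od i) * \<theta> * prob h $ i" for i
    by (intro mult_pos_pos demand_pos theta_pos logit_prob_pos)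
  then have nonneg: "0 \<le> d (od i) * \<theta> * prob h $ i * (y $ i - m (od i))\<^sup>2" for i
    by (intro mult_nonneg_nonneg[OF less_imp_le zero_le_power2])
  ultimately have "(\<Sum>i\<in>UNIV. d (od i) * \<theta> * prob h $ i * (y $ i - m (od i))\<^sup>2) = 0"
    by (intro antisym sum_nonneg)
  then have "d (od i) * \<theta> * prob h $ i * (y $ i - m (od i))\<^sup>2 = 0" for i
    by (subst (asm) sum_nonneg_eq_0_iff) (use nonneg in auto)
  \<comment> \<open>So \<open>y\<close> is constant on each OD pair, and the softmax differential
    annihilates such vectors.\<close>
  then have "y $ i - m (od i) = 0" for i
    using pos[of i] by (metis less_irrefl mult_eq_0_iff zero_eq_power2)
  then show ?thesis
    by (simp add: vec_eq_iff xi logit_diff_def m_def)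
qed

text \<open>An injective linear map of a finite-dimensional space to itself is bijective. This also
  makes the \<open>THE\<close> in \<open>newton_step\<close> denote the solution.\<close>

lemma newton_system_unique_solution:
  assumes "feasible od d h"
  shows "\<exists>!x. solves_newton od route \<tau> \<theta> h x"
proof -
  let ?A = "mat 1 - K h"
  have inj: "inj ((*v) ?A)"
    using newton_matrix_kernel[OF assms]
    by (subst linear_injective_0) (auto intro: matrix_vector_mul_linear)
  then have "surj ((*v) ?A)"
    by (intro linear_injective_imp_surjective) auto
  with inj show ?thesis
    unfolding solves_newton_def by (metis injD surjD)
qed

lemma newton_step_solves:
  assumes "feasible od d h"
  shows "(mat 1 - K h) *v newton_step od route \<tau> \<theta> h = L h - h"
  using theI'[OF newton_system_unique_solution[OF assms]]
  by (simp add: newton_step_def solves_newton_def)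

lemma continuous_on_path_costs: "continuous_on F (path_costs route \<tau>)"
proof -
  have "continuous_on F (\<lambda>h. \<tau> l (link_flow route h $ l))" for l
    by (rule continuous_on_compose2[OF continuous_on_link_cost[of l]])
      (auto intro: continuous_on_link_flow continuous_on_id)
  then show ?thesis
    unfolding path_costs_def link_costs_def matrix_vector_mult_def
    by (intro continuous_intros) (simp_all)
qed

text \<open>Joint continuity in flow and direction allows a minimum to be taken over both at
  once.\<close>

lemma continuous_on_K_mult: "continuous_on (F \<times> UNIV) (\<lambda>z. K (fst z) *v snd z)"
proof -
  have c: "continuous_on (F \<times> UNIV) (\<lambda>z. path_costs route \<tau> (fst z) $ i)" for i
    by (intro continuous_intros continuous_on_compose2[OF continuous_on_path_costs]) auto
  have 1: "continuous_on (F \<times> UNIV) (\<lambda>z. prob (fst z) $ i)" for i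
    unfolding logit_prob_def vec_lambda_beta
    by (intro continuous_intros c ballI less_imp_neq[OF exp_sum_pos, symmetric])
  have t: "continuous_on (F \<times> UNIV) (\<lambda>z. deriv_nonneg (\<tau> l) (link_flow route (fst z) $ l))" for l
    by (rule continuous_on_compose2[OF continuous_on_deriv[of l]]) (auto intro!: continuous_intros)
  have 2: "continuous_on (F \<times> UNIV)
      (\<lambda>z. (path_costs_jacobian route \<tau> (fst z) *v snd z) $ i)" for i
    unfolding path_costs_jacobian_mult matrix_vector_mult_def[of "transpose _"] vec_lambda_beta
    by (intro continuous_intros t)
  have "continuous_on (F \<times> UNIV) (\<lambda>z. \<chi> i. d (od i) *
      logit_diff od \<theta> (prob (fst z)) (path_costs_jacobian route \<tau> (fst z) *v snd z) $ i)"
    unfolding logit_diff_def od_mean_def by (simp, intro continuous_intros 1 2)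
  \<comment> \<open>The formula with fixed demands agrees with the action of \<open>K\<close> on
    feasible flows, where the OD sums equal \<open>d\<close>.\<close>
  then show ?thesis
    by (rule continuous_on_eq) (auto simp: vec_eq_iff K_mult_component)
qed

text \<open>Compactness of the feasible set makes the bound on the inverse of the Newton matrix uniform.\<close>

lemma newton_matrix_bounded_below:
  "\<exists>m>0. \<forall>h\<in>F. \<forall>x. m * norm x \<le> norm ((mat 1 - K h) *v x)"
proof (cases "F = {}")
  case False
  let ?f = "\<lambda>z. norm ((mat 1 - K (fst z)) *v snd z)"
  let ?S = "F \<times> (sphere 0 1 :: (real ^ 'p) set)"
  have "continuous_on ?S (\<lambda>z. K (fst z) *v snd z)"
    by (rule continuous_on_subset[OF continuous_on_K_mult]) auto
  then have "continuous_on ?S ?f"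
    unfolding matrix_vector_mult_diff_rdistrib matrix_vector_mul_lid
    by (intro continuous_intros)
  moreover have "?S \<noteq> {}" "compact ?S"
    using False by (auto intro: compact_Times compact_feasible)
  ultimately obtain z where z: "z \<in> ?S" "\<And>y. y \<in> ?S \<Longrightarrow> ?f z \<le> ?f y"
    using continuous_attains_inf[of ?S ?f] by blast
  \<comment> \<open>The minimiser is a feasible flow paired with a unit direction, so the trivial
    kernel makes the minimum positive. Homogeneity then extends the bound to all vectors.\<close>
  have "?f z > 0"
    using newton_matrix_kernel[of "fst z" "snd z"] z(1) by auto
  moreover have "?f z * norm x \<le> norm ((mat 1 - K h) *v x)" if "h \<in> F" for h x
  proof (cases "x = 0")
    case False
    have "?f z \<le> norm ((mat 1 - K h) *v (x /\<^sub>R norm x))"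
      using z(2)[of "(h, x /\<^sub>R norm x)"] False that by simp
    also have "\<dots> = norm ((mat 1 - K h) *v x) / norm x"
      by (simp add: matrix_vector_mult_scaleR divide_inverse mult.commute)
    finally show ?thesis
      using False by (simp add: field_simps)
  qed simp
  ultimately show ?thesis by blast
qed (auto intro: exI[of _ 1])

section \<open>Demand preservation and quadratic error of the Newton step\<close>

lemma od_sum_newton_step:
  assumes "feasible od d h"
  shows "(\<Sum>i | od i = w. newton_step od route \<tau> \<theta> h $ i) = 0"
proof -
  let ?x = "newton_step od route \<tau> \<theta> h"
  \<comment> \<open>In this form all OD sums are known: those of \<open>L h\<close> and
    \<open>h\<close> agree, and those of the image of \<open>K h\<close> vanish.\<close>
  have "?x = L h - h + K h *v ?x"
    using newton_step_solves[OF assms]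
    unfolding matrix_vector_mult_diff_rdistrib matrix_vector_mul_lid by (rule diff_eq_eq[THEN iffD1])
  then have "(\<Sum>i | od i = w. ?x $ i) = (\<Sum>i | od i = w. (L h - h + K h *v ?x) $ i)"
    by (rule arg_cong)
  also have "\<dots> = 0"
    using assms od_sum_L[OF assms, of w] od_sum_logit_diff
    by (simp add: sum.distrib sum_subtractf K_mult_component feasible_def)
  finally show ?thesis .
qed

lemma newton_step_quadratic:
  "\<exists>C>0. \<forall>g h. feasible od d g \<longrightarrow> g = L g \<longrightarrow> feasible od d h \<longrightarrow>
     norm (h + newton_step od route \<tau> \<theta> h - g) \<le> C * (norm (h - g))\<^sup>2"
proof -
  obtain C where C: "C \<ge> 0" "\<And>g h. g \<in> F \<Longrightarrow> h \<in> F \<Longrightarrow>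
      norm (L g - L h - K h *v (g - h)) \<le> C * (norm (g - h))\<^sup>2"
    using logit_map_taylor by blast
  obtain m where m: "m > 0" "\<And>h x. h \<in> F \<Longrightarrow> m * norm x \<le> norm ((mat 1 - K h) *v x)"
    using newton_matrix_bounded_below by blast
  \<comment> \<open>Dividing by \<open>m\<close> undoes the Newton matrix; \<open>C + 1\<close>
    keeps the constant positive when the Taylor constant is 0.\<close>
  have "norm (h + newton_step od route \<tau> \<theta> h - g) \<le> ((C + 1) / m) * (norm (h - g))\<^sup>2"
    if g: "feasible od d g" "g = L g" and h: "feasible od d h" for g h
  proof -
    let ?x = "newton_step od route \<tau> \<theta> h"
    have "h + ?x - g = ?x - (g - h)" by simp
    then have "(mat 1 - K h) *v (h + ?x - g) = (mat 1 - K h) *v ?x - (mat 1 - K h) *v (g - h)"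
      by (simp only: matrix_vector_mult_diff_distrib)
    \<comment> \<open>The terms \<open>h\<close> cancel, and the remaining \<open>g\<close> is
      replaced by \<open>L g\<close>, which produces the Taylor remainder at
      \<open>h\<close>.\<close>
    also have "\<dots> = L h - L g + K h *v (g - h)"
      using g(2)[symmetric] newton_step_solves[OF h] by (simp add: matrix_vector_mult_diff_rdistrib)
    also have "\<dots> = - (L g - L h - K h *v (g - h))"
      by simp
    finally have "norm ((mat 1 - K h) *v (h + ?x - g)) = norm (L g - L h - K h *v (g - h))"
      by (simp only: norm_minus_cancel)
    also have "\<dots> \<le> C * (norm (g - h))\<^sup>2"
      using C(2) g(1) h by simp
    also have "\<dots> \<le> (C + 1) * (norm (h - g))\<^sup>2"
      by (simp add: norm_minus_commute mult_right_mono)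
    finally have "m * norm (h + ?x - g) \<le> (C + 1) * (norm (h - g))\<^sup>2"
      using m(2)[of h "h + ?x - g"] h by simp
    then show ?thesis
      using m(1) by (simp add: field_simps)
  qed
  moreover have "(C + 1) / m > 0"
    using C(1) m(1) by simp
  ultimately show ?thesis by blast
qed

end

section \<open>Positivity and local quadratic convergence near the equilibrium\<close>

theorem mainTheorem6:
  fixes tail head :: "'l::finite \<Rightarrow> 'v"
    and orig dest :: "'w::finite \<Rightarrow> 'v"
    and od :: "'p::finite \<Rightarrow> 'w"
    and route :: "'p \<Rightarrow> 'l list"
    and d :: "'w \<Rightarrow> real"
    and \<tau> :: "'l \<Rightarrow> real \<Rightarrow> real"
    and \<theta> :: real
    and hhat :: "real ^ 'p"
  assumes "network tail head orig dest od route"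
    and "\<forall>w. 0 < d w"
    and "admissible_link_costs od d route \<tau>"
    and "0 < \<theta>"
    and "feasible od d hhat"
    and "hhat = logit_map od route \<tau> \<theta> hhat"
  shows "(\<forall>h. feasible od d h \<longrightarrow> (\<exists>!x. solves_newton od route \<tau> \<theta> h x)) \<and>
    (\<exists>U. open U \<and> hhat \<in> U \<and>
      (\<forall>h\<in>U. feasible od d h \<longrightarrow>
         feasible od d (h + newton_step od route \<tau> \<theta> h) \<and>
         (\<forall>i. 0 < (h + newton_step od route \<tau> \<theta> h) $ i))) \<and>
    (\<exists>U. open U \<and> hhat \<in> U \<and>
      (\<forall>h0\<in>U. feasible od d h0 \<longrightarrow>
         (\<forall>k. feasible od d (newton_iter od route \<tau> \<theta> h0 k) \<and>
              (\<exists>!x. solves_newton od route \<tau> \<theta> (newton_iter od route \<tau> \<theta> h0 k) x)) \<and>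
         newton_iter od route \<tau> \<theta> h0 \<longlonglongrightarrow> hhat \<and>
         (\<exists>C>0. \<forall>k. norm (newton_iter od route \<tau> \<theta> h0 (Suc k) - hhat)
                     \<le> C * (norm (newton_iter od route \<tau> \<theta> h0 k - hhat))\<^sup>2)))"
proof -
  interpret logit_network od d route \<tau> \<theta>
    using assms by unfold_locales (auto simp: network_def)
  let ?N = "\<lambda>h. h + newton_step od route \<tau> \<theta> h"
  obtain C where C: "C > 0" and quad: "\<And>h. feasible od d h \<Longrightarrow>
      norm (?N h - hhat) \<le> C * (norm (h - hhat))\<^sup>2"
    using newton_step_quadratic assms(5,6) by metis
  have hhat_pos: "0 < hhat $ i" for i
    using L_component[OF assms(5), of i] assms(6) demand_pos[of "od i"]
      logit_prob_pos[of od \<theta> "path_costs route \<tau> hhat" i] by simp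
  \<comment> \<open>The smallest equilibrium path flow: vectors closer than this to
    \<open>hhat\<close> have positive entries.\<close>
  define e where "e = Min (range (($) hhat))"
  have e: "0 < e" "\<And>i. e \<le> hhat $ i"
    by (auto simp: e_def hhat_pos)
  \<comment> \<open>Within distance \<open>1 / (2 * C)\<close> the quadratic bound at least halves
    the error; the bound by \<open>e\<close> secures positivity. The same ball serves as both
    neighborhoods.\<close>
  define r where "r = min (1 / (2 * C)) e"
  have r: "0 < r" "r \<le> e" "C * r \<le> 1 / 2"
  proof -
    show "0 < r" "r \<le> e" using C e by (auto simp: r_def)
    have "C * r \<le> C * (1 / (2 * C))"
      using C by (intro mult_left_mono) (auto simp: r_def)
    then show "C * r \<le> 1 / 2" using C by simp
  qed
  have step: "norm (?N h - hhat) \<le> norm (h - hhat) / 2 \<and> feasible od d (?N h) \<and> (\<forall>i. 0 < ?N h $ i)"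
    if h: "feasible od d h" "h \<in> ball hhat r" for h
  proof -
    have near: "norm (h - hhat) < r"
      using h(2) by (simp add: dist_norm norm_minus_commute)
    have "C * norm (h - hhat) \<le> C * r"
      using near C by (intro mult_left_mono) auto
    then have "C * norm (h - hhat) * norm (h - hhat) \<le> 1 / 2 * norm (h - hhat)"
      using r(3) by (intro mult_right_mono) auto
    then have half: "norm (?N h - hhat) \<le> norm (h - hhat) / 2"
      using quad[OF h(1)] by (simp add: power2_eq_square mult.assoc)
    have pos: "0 < ?N h $ i" for i
    proof -
      have "\<bar>(?N h - hhat) $ i\<bar> \<le> norm (?N h - hhat)"
        by (rule component_le_norm_cart)
      also have "\<dots> < e"
        using half near r norm_ge_zero[of "h - hhat"] by linarith
      finally show ?thesis
        using e(2)[of i] by auto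
    qed
    have "(\<Sum>i | od i = w. ?N h $ i) = d w" for w
      using h(1) od_sum_newton_step[OF h(1), of w] by (simp add: sum.distrib feasible_def)
    with pos half show ?thesis
      by (simp add: feasible_def less_imp_le)
  qed
  \<comment> \<open>Feasibility and membership in the ball let \<open>step\<close> be applied again;
    the geometric bound yields convergence.\<close>
  have iter: "feasible od d (newton_iter od route \<tau> \<theta> h0 k) \<and>
      norm (newton_iter od route \<tau> \<theta> h0 k - hhat) \<le> r * (1 / 2) ^ k \<and>
      newton_iter od route \<tau> \<theta> h0 k \<in> ball hhat r"
    if "feasible od d h0" "h0 \<in> ball hhat r" for h0 k
  proof (induction k)
    case 0
    then show ?case
      using that by (simp add: newton_iter_def dist_norm norm_minus_commute)
  next
    case (Suc k)
    let ?h = "newton_iter od route \<tau> \<theta> h0 k"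
    have "newton_iter od route \<tau> \<theta> h0 (Suc k) = ?N ?h"
      by (simp add: newton_iter_def)
    moreover have "norm (?N ?h - hhat) < r"
      using step[of ?h] Suc norm_ge_zero[of "?h - hhat"]
      by (auto simp: dist_norm norm_minus_commute simp del: norm_ge_zero)
    moreover have "norm (?N ?h - hhat) \<le> r * (1 / 2) ^ Suc k" "feasible od d (?N ?h)"
      using step[of ?h] Suc by auto
    ultimately show ?case
      by (simp add: dist_norm norm_minus_commute)
  qed
  have conv: "newton_iter od route \<tau> \<theta> h0 \<longlonglongrightarrow> hhat"
    if "feasible od d h0" "h0 \<in> ball hhat r" for h0
  proof (rule LIM_zero_cancel, rule Lim_null_comparison)
    show "\<forall>\<^sub>F k in sequentially. norm (newton_iter od route \<tau> \<theta> h0 k - hhat) \<le> r * (1 / 2) ^ k"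
      using iter[OF that] by simp
    show "(\<lambda>k. r * (1 / 2) ^ k) \<longlonglongrightarrow> 0"
      by (intro tendsto_mult_right_zero LIMSEQ_realpow_zero) auto
  qed
  have quad_iter: "norm (newton_iter od route \<tau> \<theta> h0 (Suc k) - hhat)
      \<le> C * (norm (newton_iter od route \<tau> \<theta> h0 k - hhat))\<^sup>2"
    if "feasible od d h0" "h0 \<in> ball hhat r" for h0 k
    using quad[of "newton_iter od route \<tau> \<theta> h0 k"] iter[OF that, of k]
    by (simp add: newton_iter_def)
  have U: "open (ball hhat r)" "hhat \<in> ball hhat r"
    using r(1) by auto
  show ?thesis
  proof (rule conjI[OF _ conjI[OF exI[of _ "ball hhat r"] exI[of _ "ball hhat r"]]],
      goal_cases)
    case 1
    show ?case using newton_system_unique_solution by blast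
  next
    case 2
    show ?case using U step by blast
  next
    case 3
    show ?case
      by (intro conjI U ballI impI allI newton_system_unique_solution conv exI[of _ C] C quad_iter)
        (simp_all only: iter)
  qed
qed

end
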